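(* Let $d=3k$ with $k=2+3l$, where $l\geq 1$ is an integer. Then the candidate branching datum $$\bigl(d,\{[\underbrace{3,\ldots,3}_{k-1},1,1,1],[\underbrace{3,\ldots,3}_{k}],[\underbrace{3,\ldots,3}_{k}]\}\bigr)$$ on the Riemann sphere is exceptional.
   Context: The setting is rational maps $\overline{\mathbb{C}}\to\overline{\mathbb{C}}$ of the Riemann sphere $\overline{\mathbb{C}}=\mathbb{C}\cup\{\infty\}$. Square brackets denote unordered lists with repetitions (multisets). For a non-constant rational map $h$ of degree $d$ and $x\in\overline{\mathbb{C}}$, let $\mu(x)$ be the partition of $d$ formed by the local degrees (multiplicities) of $h$ at the points of $h^{-1}(x)$. The branching points of $h$ are the points $x$ for which $\mu(x)$ is not the trivial partition $[1,\ldots,1]$, and the branching datum of $h$ is the collection (with repetitions) of the partitions $\mu(x)$ over all branching points $x$. A pair $(d,\mathcal{D})$, with $d\geq 2$ an integer and $\mathcal{D}$ a finite collection (with repetitions) of nontrivial partitions of $d$ having $r_1,\ldots,r_n$ parts respectively, is a candidate branching datum (on the sphere) if it satisfies the Riemann-Hurwitz formula $\sum_{i=1}^{n}(d-r_i)=2d-2$. A candidate branching datum $(d,\mathcal{D})$ is exceptional if there is no rational map $\overline{\mathbb{C}}\to\overline{\mathbb{C}}$ of degree $d$ whose branching datum is $\mathcal{D}$. *)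

theory Defs
  imports "HOL-Complex_Analysis.Complex_Analysis"
    "HOL-Computational_Algebra.Computational_Algebra"
begin

(* The Riemann sphere, as the carrier of the one-point compactification of the complex plane;
   None is the point at infinity. *)
type_synonym riemann_sphere = "complex option"

(* The map z |-> p(z)/q(z), meant for coprime p, q. With m = max (deg p) (deg q), the coefficients
   of z^m are the values at infinity = [1 : 0] of the homogenizations of p and q. *)
definition sphere_map :: "complex poly \<Rightarrow> complex poly \<Rightarrow> riemann_sphere \<Rightarrow> riemann_sphere" where
  "sphere_map p q x =
    (case x of
       Some z \<Rightarrow> if poly q z = 0 then None else Some (poly p z / poly q z)
     | None \<Rightarrow>
         (let m = max (degree p) (degree q)
          in if coeff q m = 0 then None else Some (coeff p m / coeff q m)))"

definition rational_map_of_degree :: "nat \<Rightarrow> (riemann_sphere \<Rightarrow> riemann_sphere) \<Rightarrow> bool" where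
  "rational_map_of_degree d h \<longleftrightarrow>
    (\<exists>p q. coprime p q \<and> max (degree p) (degree q) = d \<and> h = sphere_map p q)"

(* Holomorphic charts centred at a given point, and their inverses. The value of sphere_chart a
   at the one point outside the domain of the chart is a dummy 0. *)
definition sphere_chart :: "riemann_sphere \<Rightarrow> riemann_sphere \<Rightarrow> complex" where
  "sphere_chart a x =
    (case a of
       Some c \<Rightarrow> (case x of Some z \<Rightarrow> z - c | None \<Rightarrow> 0)
     | None \<Rightarrow> (case x of Some z \<Rightarrow> 1 / z | None \<Rightarrow> 0))"

definition sphere_chart_inv :: "riemann_sphere \<Rightarrow> complex \<Rightarrow> riemann_sphere" where
  "sphere_chart_inv a w =
    (case a of
       Some c \<Rightarrow> Some (c + w)
     | None \<Rightarrow> if w = 0 then None else Some (1 / w))"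

(* Only the germ at 0 of the local expression matters; h is assumed rational and non-constant. *)
definition local_degree :: "(riemann_sphere \<Rightarrow> riemann_sphere) \<Rightarrow> riemann_sphere \<Rightarrow> nat" where
  "local_degree h x = nat (zorder (\<lambda>w. sphere_chart (h x) (h (sphere_chart_inv x w))) 0)"

definition fibre_partition :: "(riemann_sphere \<Rightarrow> riemann_sphere) \<Rightarrow> riemann_sphere \<Rightarrow> nat multiset" where
  "fibre_partition h x = image_mset (local_degree h) (mset_set (h -` {x}))"

definition trivial_partition :: "nat multiset \<Rightarrow> bool" where
  "trivial_partition \<pi> \<longleftrightarrow> (\<forall>k \<in># \<pi>. k = 1)"

definition branching_points :: "(riemann_sphere \<Rightarrow> riemann_sphere) \<Rightarrow> riemann_sphere set" where
  "branching_points h = {x. \<not> trivial_partition (fibre_partition h x)}"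

(* Fibres and branching_points h are finite for h rational and non-constant, so no infinite set
   is fed to mset_set in this case. *)
definition branching_datum :: "(riemann_sphere \<Rightarrow> riemann_sphere) \<Rightarrow> nat multiset multiset" where
  "branching_datum h = image_mset (fibre_partition h) (mset_set (branching_points h))"

definition is_partition_of :: "nat multiset \<Rightarrow> nat \<Rightarrow> bool" where
  "is_partition_of \<pi> d \<longleftrightarrow> 0 \<notin># \<pi> \<and> sum_mset \<pi> = d"

definition candidate_branching_datum :: "nat \<Rightarrow> nat multiset multiset \<Rightarrow> bool" where
  "candidate_branching_datum d D \<longleftrightarrow>
    d \<ge> 2 \<and>
    (\<forall>\<pi> \<in># D. is_partition_of \<pi> d \<and> \<not> trivial_partition \<pi>) \<and>
    (\<Sum>\<pi> \<in># D. int d - int (size \<pi>)) = 2 * int d - 2"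

definition exceptional :: "nat \<Rightarrow> nat multiset multiset \<Rightarrow> bool" where
  "exceptional d D \<longleftrightarrow>
    candidate_branching_datum d D \<and>
    \<not> (\<exists>h. rational_map_of_degree d h \<and> branching_datum h = D)"

end

theory Submission
  imports Defs
begin

text \<open>
  Suppose a rational map \<open>h = p/q\<close> of degree \<open>d = 3 * k\<close> with \<open>k mod 3 = 2\<close> had this branching
  datum, with the three branching points \<open>a1\<close>, \<open>a2\<close>, \<open>a3\<close> in the listed order. The fibre over a
  point \<open>a\<close> is the zero divisor of a binary form of degree \<open>d\<close>, namely \<open>p - a q\<close>, or \<open>q\<close> for
  \<open>a = \<infinity>\<close>. The three forms over \<open>a1\<close>, \<open>a2\<close>, \<open>a3\<close> lie in the plane spanned by \<open>p\<close> and \<open>q\<close>, so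
  after scaling they satisfy \<open>N1 = N2 + N3\<close>. All zeros of \<open>N2\<close> and \<open>N3\<close> are triple, so both are
  cubes of forms of degree \<open>k\<close>, and with a primitive cube root of unity \<open>\<omega>\<close>
  \[ N_1 = V^3 + W^3 = (V + W)(V + \omega W)(V + \omega^2 W). \]
  The three factors have no common zeros in pairs, because such a point would be a zero of \<open>V\<close> and
  of \<open>W\<close> and thus lie over both \<open>a2\<close> and \<open>a3\<close>. Hence a zero of one factor has the same
  multiplicity as in \<open>N1\<close>, that is \<open>1\<close> or \<open>3\<close>. A factor has \<open>k\<close> zeros with multiplicity, and
  \<open>k mod 3 = 2\<close>, so it has at least two simple zeros. Then \<open>N1\<close> has at least six
  simple zeros, whereas the datum grants it only three.

  Binary forms of degree \<open>m\<close> are represented by polynomials of degree at most \<open>m\<close>, with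
  \<open>m - degree P\<close> as the multiplicity of the zero at infinity. The analytic input is that the local
  degree of \<open>h\<close> at \<open>x\<close> is the multiplicity of \<open>x\<close> as a zero of the form over \<open>h x\<close>
  (\<open>local_degree_sphere_map\<close>); the arithmetic core is \<open>six_simple_zeros_of_sum_of_cubes\<close>.
\<close>

section \<open>Zeros of binary forms on the sphere\<close>

text \<open>
  The value at infinity is the value at \<open>[1 : 0]\<close> of the homogenization of degree \<open>m\<close>, so it depends
  on \<open>m\<close> and is linear in \<open>P\<close>.
\<close>
definition form_value :: "nat \<Rightarrow> complex poly \<Rightarrow> riemann_sphere \<Rightarrow> complex" where
  "form_value m P x = (case x of Some z \<Rightarrow> poly P z | None \<Rightarrow> coeff P m)"

definition form_zeros :: "nat \<Rightarrow> complex poly \<Rightarrow> riemann_sphere multiset" where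
  "form_zeros m P = image_mset Some (proots P) + replicate_mset (m - degree P) None"

lemma form_value_add [simp]: "form_value m (P + Q) x = form_value m P x + form_value m Q x"
  by (simp add: form_value_def split: option.splits)

lemma form_value_diff [simp]: "form_value m (P - Q) x = form_value m P x - form_value m Q x"
  by (simp add: form_value_def split: option.splits)

lemma form_value_smult [simp]: "form_value m (smult c P) x = c * form_value m P x"
  by (simp add: form_value_def split: option.splits)

lemma count_form_zeros_Some:
  assumes "P \<noteq> 0"
  shows "count (form_zeros m P) (Some z) = order z P"
proof -
  have "count (image_mset Some A) (Some z) = count A z" for A :: "complex multiset"
    by (induction A) auto
  then show ?thesis
    using assms by (simp add: form_zeros_def)
qed

lemma count_form_zeros_None: "count (form_zeros m P) None = m - degree P"
  by (auto simp: form_zeros_def count_eq_zero_iff)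

lemma in_form_zeros_iff:
  assumes "P \<noteq> 0" "degree P \<le> m"
  shows "x \<in># form_zeros m P \<longleftrightarrow> form_value m P x = 0"
proof (cases x)
  case None
  have "coeff P m = 0 \<longleftrightarrow> degree P < m"
    using assms by (metis coeff_eq_0 le_neq_implies_less leading_coeff_0_iff)
  then show ?thesis
    using None by (auto simp: form_zeros_def form_value_def)
next
  case (Some z)
  then show ?thesis
    using assms by (auto simp: form_zeros_def form_value_def)
qed

lemma size_form_zeros: "degree P \<le> m \<Longrightarrow> size (form_zeros m P) = m"
  by (simp add: form_zeros_def size_proots_complex)

lemma form_zeros_smult [simp]: "c \<noteq> 0 \<Longrightarrow> form_zeros m (smult c P) = form_zeros m P"
  by (simp add: form_zeros_def)

lemma form_zeros_mult:
  assumes "P \<noteq> 0" "Q \<noteq> 0" "degree P \<le> m" "degree Q \<le> n"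
  shows "form_zeros (m + n) (P * Q) = form_zeros m P + form_zeros n Q"
proof -
  have "m + n - degree (P * Q) = (m - degree P) + (n - degree Q)"
    using assms by (simp add: degree_mult_eq)
  then show ?thesis
    using assms by (intro multiset_eqI) (simp add: form_zeros_def proots_mult)
qed

lemma poly_nth_root_exists:
  fixes P :: "complex poly"
  assumes "P \<noteq> 0" "n > 0" "\<And>z. n dvd order z P"
  shows "\<exists>V. V ^ n = P"
proof -
  obtain c where c: "c ^ n = lead_coeff P"
    using nth_root_exists[OF \<open>n > 0\<close>] by blast
  define V where "V = smult c (\<Prod>z | poly P z = 0. [:- z, 1:] ^ (order z P div n))"
  have "V ^ n = smult (lead_coeff P) (\<Prod>z | poly P z = 0. [:- z, 1:] ^ order z P)"
    using assms(3)
    by (simp add: V_def smult_power c prod_power_distrib flip: power_mult)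
  also have "\<dots> = P"
    by (rule complex_poly_decompose)
  finally show ?thesis ..
qed

lemma cube_root_of_form:
  fixes P :: "complex poly"
  assumes "P \<noteq> 0" "degree P \<le> 3 * k" "\<And>x. x \<in># form_zeros (3 * k) P \<Longrightarrow> count (form_zeros (3 * k) P) x = 3"
  obtains V where "V ^ 3 = P" "V \<noteq> 0" "degree V \<le> k"
proof -
  have "3 dvd order z P" for z
    using assms(3)[of "Some z"] count_form_zeros_Some[OF assms(1), of "3 * k" z]
    by (metis count_eq_zero_iff dvd_0_right dvd_refl)
  then obtain V where V: "V ^ 3 = P"
    using poly_nth_root_exists[OF assms(1), of 3] by auto
  moreover have "V \<noteq> 0"
    using V assms(1) by auto
  moreover have "degree V \<le> k"
    using V assms(2) degree_power_eq[OF \<open>V \<noteq> 0\<close>, of 3] by auto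
  ultimately show ?thesis
    using that by blast
qed

section \<open>Fibres of a rational map\<close>

definition fibre_poly :: "complex poly \<Rightarrow> complex poly \<Rightarrow> riemann_sphere \<Rightarrow> complex poly" where
  "fibre_poly p q a = (case a of Some c \<Rightarrow> p - smult c q | None \<Rightarrow> q)"

text \<open>
  In the chart centred at \<open>a\<close> the map \<open>p/q\<close> is \<open>fibre_poly p q a\<close> divided by this polynomial.
\<close>
definition fibre_denom :: "complex poly \<Rightarrow> complex poly \<Rightarrow> riemann_sphere \<Rightarrow> complex poly" where
  "fibre_denom p q a = (case a of Some c \<Rightarrow> q | None \<Rightarrow> p)"

lemma sphere_map_eq_form_value:
  assumes "d = max (degree p) (degree q)"
  shows "sphere_map p q x =
    (if form_value d q x = 0 then None else Some (form_value d p x / form_value d q x))"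
  using assms by (auto simp: sphere_map_def form_value_def Let_def split: option.splits)

lemma degree_fibre_poly_le: "degree (fibre_poly p q a) \<le> max (degree p) (degree q)"
  by (auto simp: fibre_poly_def degree_diff_le_max intro!: degree_diff_le split: option.splits)

lemma fibre_poly_nonzero:
  assumes "coprime p q" "max (degree p) (degree q) > 0"
  shows "fibre_poly p q a \<noteq> 0"
proof
  assume zero: "fibre_poly p q a = 0"
  have "q dvd p \<and> is_unit q \<or> q = 0 \<and> is_unit p"
  proof (cases a)
    case None
    then show ?thesis
      using zero assms(1) by (simp add: fibre_poly_def)
  next
    case (Some c)
    then have "p = smult c q"
      using zero by (simp add: fibre_poly_def)
    then have "q dvd p"
      by (simp add: dvd_smult)
    then show ?thesis
      using assms(1) by (meson coprime_common_divisor dvd_refl)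
  qed
  then have "degree p = 0 \<and> degree q = 0"
    using zero by (auto simp: is_unit_poly_iff fibre_poly_def split: option.splits dest!: dvd_imp_degree_le)
  then show False
    using assms(2) by simp
qed

lemma form_values_not_both_zero:
  assumes "coprime p q" "d = max (degree p) (degree q)" "d > 0"
  shows "form_value d p x \<noteq> 0 \<or> form_value d q x \<noteq> 0"
proof (cases x)
  case None
  then show ?thesis
    using assms(2,3) by (auto simp: form_value_def max_def split: if_splits)
next
  case (Some z)
  then show ?thesis
    using coprime_poly_0[OF assms(1)] by (auto simp: form_value_def)
qed

lemma sphere_map_eq_iff:
  assumes "coprime p q" "d = max (degree p) (degree q)" "d > 0"
  shows "sphere_map p q x = a \<longleftrightarrow> form_value d (fibre_poly p q a) x = 0"
  using form_values_not_both_zero[OF assms, of x]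
  by (auto simp: sphere_map_eq_form_value[OF assms(2)] fibre_poly_def field_simps
      split: option.splits)

lemma vimage_sphere_map:
  assumes "coprime p q" "d = max (degree p) (degree q)" "d > 0"
  shows "sphere_map p q -` {a} = set_mset (form_zeros d (fibre_poly p q a))"
proof -
  have "fibre_poly p q a \<noteq> 0" "degree (fibre_poly p q a) \<le> d"
    using assms fibre_poly_nonzero degree_fibre_poly_le by auto
  then show ?thesis
    by (intro set_eqI) (simp add: sphere_map_eq_iff[OF assms] in_form_zeros_iff)
qed

text \<open>
  The dummy value of the chart and division by zero agree: both sides are \<open>0\<close> where \<open>p/q\<close> takes the
  one value that the chart at \<open>a\<close> misses. So the formula holds at every \<open>z\<close>, not only near the fibre.
\<close>
lemma sphere_chart_sphere_map:
  "sphere_chart a (sphere_map p q (Some z)) = poly (fibre_poly p q a) z / poly (fibre_denom p q a) z"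
  by (auto simp: sphere_chart_def sphere_map_def fibre_poly_def fibre_denom_def field_simps
      split: option.splits)

lemma fibre_denom_nonzero_on_fibre:
  assumes "coprime p q" "d = max (degree p) (degree q)" "d > 0" "sphere_map p q x = a"
  shows "form_value d (fibre_denom p q a) x \<noteq> 0"
  using form_values_not_both_zero[OF assms(1-3), of x] assms(4)
  by (auto simp: sphere_map_eq_form_value[OF assms(2)] fibre_denom_def split: option.splits if_splits)

text \<open>
  In the charts the map is the quotient of \<open>N = fibre_poly p q a\<close>, where \<open>a\<close> is the value at \<open>x\<close>, by
  a denominator that does not vanish at \<open>x\<close>, so its order is that of \<open>N\<close>.
  At infinity, with the coordinate \<open>w = 1/z\<close>, both polynomials are replaced by their reflections,
  which do not vanish at \<open>0\<close>; the denominator has the full degree \<open>d\<close>, so a factor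
  \<open>w ^ (d - degree N)\<close> is left over.
\<close>
lemma local_degree_sphere_map:
  assumes "coprime p q" "d = max (degree p) (degree q)" "d > 0"
  shows "local_degree (sphere_map p q) x
    = count (form_zeros d (fibre_poly p q (sphere_map p q x))) x"
proof -
  define a where "a = sphere_map p q x"
  define N where "N = fibre_poly p q a"
  define M where "M = fibre_denom p q a"
  define f where "f = (\<lambda>w. sphere_chart a (sphere_map p q (sphere_chart_inv x w)))"
  have N0: "N \<noteq> 0" and dN: "degree N \<le> d"
    using assms fibre_poly_nonzero degree_fibre_poly_le by (auto simp: N_def)
  have M0: "form_value d M x \<noteq> 0"
    using fibre_denom_nonzero_on_fibre[OF assms] by (simp add: M_def a_def)
  have dM: "degree M \<le> d"
    using assms by (auto simp: M_def fibre_denom_def split: option.splits)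
  have f: "f w = poly N z / poly M z" if "sphere_chart_inv x w = Some z" for w z
    using that by (simp add: f_def sphere_chart_sphere_map N_def M_def)
  have "zorder f 0 = int (count (form_zeros d N) x)"
  proof (cases x)
    case (Some z)
    obtain R where R: "N = [:- z, 1:] ^ order z N * R" "\<not> [:- z, 1:] dvd R"
      using order_decomp[OF N0] by blast
    have Rz: "poly R z \<noteq> 0"
      using R(2) by (simp add: poly_eq_0_iff_dvd)
    have Mz: "poly M z \<noteq> 0"
      using M0 Some by (simp add: form_value_def)
    define S where "S = {w. poly M (z + w) \<noteq> 0}"
    define g where "g = (\<lambda>w. poly R (z + w) / poly M (z + w))"
    have "zorder f 0 = int (order z N)"
    proof (rule zorder_eqI)
      show "open S"
        unfolding S_def by (intro open_Collect_neq continuous_intros)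
      show "0 \<in> S" "g 0 \<noteq> 0"
        using Mz Rz by (auto simp: S_def g_def)
      show "g holomorphic_on S"
        unfolding g_def S_def by (intro holomorphic_intros) auto
      show "f w = g w * (w - 0) powi int (order z N)" for w
      proof -
        have "poly N (z + w) = w ^ order z N * poly R (z + w)"
          by (subst R(1)) simp
        then show ?thesis
          using f[of w "z + w"] Some by (simp add: sphere_chart_inv_def g_def)
      qed
    qed
    then show ?thesis
      using Some N0 by (simp add: count_form_zeros_Some)
  next
    case None
    have degM: "degree M = d"
      using M0 None dM le_degree[of M d] by (simp add: form_value_def)
    define S where "S = {w. poly (reflect_poly M) w \<noteq> 0}"
    define g where "g = (\<lambda>w. poly (reflect_poly N) w / poly (reflect_poly M) w)"
    have M_nz: "M \<noteq> 0"
      using M0 None by (auto simp: form_value_def)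
    have "zorder f 0 = int (d - degree N)"
    proof (rule zorder_eqI)
      show "open S"
        unfolding S_def by (intro open_Collect_neq continuous_intros)
      show "0 \<in> S" "g 0 \<noteq> 0"
        using N0 M_nz by (auto simp: S_def g_def)
      show "g holomorphic_on S"
        unfolding g_def S_def by (intro holomorphic_intros) auto
      show "f w = g w * (w - 0) powi int (d - degree N)" if "w \<noteq> 0" for w
      proof -
        have "w ^ d = w ^ (d - degree N) * w ^ degree N"
          using dN by (simp flip: power_add)
        then show ?thesis
          using f[of w "1 / w"] None that
          by (simp add: sphere_chart_inv_def g_def poly_reflect_poly_nz degM inverse_eq_divide)
      qed
    qed
    then show ?thesis
      using None by (simp add: count_form_zeros_None)
  qed
  then show ?thesis
    by (simp add: local_degree_def f_def N_def a_def)
qed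

lemma fibre_partition_sphere_map:
  assumes "coprime p q" "d = max (degree p) (degree q)" "d > 0"
  defines "Z \<equiv> \<lambda>a. form_zeros d (fibre_poly p q a)"
  shows "fibre_partition (sphere_map p q) a = image_mset (count (Z a)) (mset_set (set_mset (Z a)))"
proof -
  have "local_degree (sphere_map p q) x = count (Z a) x" if "x \<in># Z a" for x
    using that vimage_sphere_map[OF assms(1-3), of a] local_degree_sphere_map[OF assms(1-3), of x]
    by (auto simp: Z_def)
  moreover have "sphere_map p q -` {a} = set_mset (Z a)"
    using vimage_sphere_map[OF assms(1-3)] by (simp add: Z_def)
  ultimately show ?thesis
    unfolding fibre_partition_def by (metis finite_set_mset elem_mset_set image_mset_cong)
qed

text \<open>
  Three vectors in the plane spanned by \<open>p\<close> and \<open>q\<close> are linearly related. Up to sign the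
  coefficients are \<open>1\<close> or products and quotients of differences of the points, so they are non-zero
  for distinct points.
\<close>
lemma fibre_poly_linear_relation:
  assumes "a1 \<noteq> a2" "a1 \<noteq> a3" "a2 \<noteq> a3"
  obtains \<alpha> \<beta> where "\<alpha> \<noteq> 0" "\<beta> \<noteq> 0"
    "fibre_poly p q a1 = smult \<alpha> (fibre_poly p q a2) + smult \<beta> (fibre_poly p q a3)"
proof -
  consider (fin) c1 c2 c3 where "a1 = Some c1" "a2 = Some c2" "a3 = Some c3"
    | (inf1) c2 c3 where "a1 = None" "a2 = Some c2" "a3 = Some c3"
    | (inf2) c1 c3 where "a1 = Some c1" "a2 = None" "a3 = Some c3"
    | (inf3) c1 c2 where "a1 = Some c1" "a2 = Some c2" "a3 = None"
    using assms by (cases a1; cases a2; cases a3) auto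
  then show ?thesis
  proof cases
    case fin
    then have ne: "c2 - c3 \<noteq> 0" "c1 - c3 \<noteq> 0" "c2 - c1 \<noteq> 0"
      using assms by auto
    define \<alpha> \<beta> where "\<alpha> = (c1 - c3) / (c2 - c3)" and "\<beta> = (c2 - c1) / (c2 - c3)"
    have sum: "\<alpha> + \<beta> = 1" "\<alpha> * c2 + \<beta> * c3 = c1"
      using ne(1) unfolding \<alpha>_def \<beta>_def
      by (simp_all add: divide_simps) (simp_all add: algebra_simps)
    have "p - smult c1 q = smult (\<alpha> + \<beta>) p - smult (\<alpha> * c2 + \<beta> * c3) q"
      by (simp add: sum)
    also have "\<dots> = smult \<alpha> (p - smult c2 q) + smult \<beta> (p - smult c3 q)"
      by (simp add: smult_add_left smult_diff_right)
    finally show ?thesis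
      using ne fin by (intro that[of \<alpha> \<beta>]) (auto simp: fibre_poly_def \<alpha>_def \<beta>_def)
  next
    case inf1
    then have ne: "c3 - c2 \<noteq> 0"
      using assms by auto
    have "smult (1 / (c3 - c2)) (p - smult c2 q) + smult (- 1 / (c3 - c2)) (p - smult c3 q)
      = smult (1 / (c3 - c2)) (smult (c3 - c2) q)"
      by (simp add: smult_diff_right smult_diff_left)
    also have "\<dots> = q"
      using ne by simp
    finally show ?thesis
      using ne inf1 by (intro that[of "1 / (c3 - c2)" "- 1 / (c3 - c2)"]) (auto simp: fibre_poly_def)
  next
    case inf2
    then show ?thesis
      using assms by (intro that[of "c3 - c1" 1]) (auto simp: fibre_poly_def smult_diff_left)
  next
    case inf3
    then show ?thesis
      using assms by (intro that[of 1 "c2 - c1"]) (auto simp: fibre_poly_def smult_diff_left)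
  qed
qed

section \<open>The obstruction\<close>

text \<open>Modulo three, the size counts the elements of multiplicity one.\<close>
lemma two_simple_elements:
  fixes R :: "'a multiset"
  assumes "\<And>x. x \<in># R \<Longrightarrow> count R x = 1 \<or> count R x = 3" "size R mod 3 = 2"
  shows "card {x. count R x = 1} \<ge> 2"
proof -
  define A B where "A = {x. count R x = 1}" and "B = {x. count R x = 3}"
  have AB: "set_mset R = A \<union> B" "A \<inter> B = {}"
    using assms(1) by (auto simp: A_def B_def count_eq_zero_iff intro: count_inI)
  have fin: "finite A" "finite B"
    using AB(1) by (metis finite_Un finite_set_mset)+
  have "size R = sum (count R) A + sum (count R) B"
    using fin AB by (simp add: size_multiset_overloaded_eq sum.union_disjoint)
  also have "\<dots> = card A + 3 * card B"
    by (simp add: A_def B_def)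
  finally show ?thesis
    using assms(2) unfolding A_def by presburger
qed

lemma primitive_cube_root_exists:
  obtains \<omega> :: complex where "\<omega>\<^sup>2 = - \<omega> - 1" "\<omega> \<noteq> 1" "\<omega>\<^sup>2 \<noteq> 1" "\<omega>\<^sup>2 \<noteq> \<omega>"
proof -
  define \<omega> :: complex where "\<omega> = Complex (- 1 / 2) (sqrt 3 / 2)"
  have "\<omega>\<^sup>2 = - \<omega> - 1"
    by (simp add: \<omega>_def complex_eq_iff power2_eq_square field_simps)
  moreover from this have "\<omega>\<^sup>2 \<noteq> 1 \<and> \<omega>\<^sup>2 \<noteq> \<omega> \<and> \<omega> \<noteq> 1"
    by (auto simp: \<omega>_def complex_eq_iff)
  ultimately show ?thesis
    using that by blast
qed

lemma sum_of_cubes_factorization: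
  fixes V W :: "complex poly"
  assumes "\<omega>\<^sup>2 = - \<omega> - 1"
  shows "V ^ 3 + W ^ 3 = (V + smult 1 W) * ((V + smult \<omega> W) * (V + smult (\<omega>\<^sup>2) W))"
proof -
  \<comment> \<open>As a constant polynomial the scalar lives in the ring in which the identity is checked.\<close>
  define U where "U = [:\<omega>:]"
  have "U\<^sup>2 = - U - 1"
    using assms by (simp add: U_def power2_eq_square one_pCons)
  then have "V ^ 3 + W ^ 3 = (V + W) * ((V + U * W) * (V + U\<^sup>2 * W))"
    by algebra
  then show ?thesis
    by (simp add: U_def poly_const_pow)
qed

text \<open>
  A zero shared by two of the factors \<open>V + c W\<close> of \<open>V ^ 3 + W ^ 3\<close> would be a zero of \<open>V\<close> and of \<open>W\<close>.
  As there is none, the simple zeros of the three factors form disjoint sets of simple zeros of the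
  product, and each factor has at least two of them because it has \<open>k\<close> zeros with multiplicity.
\<close>
lemma six_simple_zeros_of_sum_of_cubes:
  fixes V W :: "complex poly"
  assumes deg: "degree V \<le> k" "degree W \<le> k"
    and disj: "\<And>x. form_value k V x \<noteq> 0 \<or> form_value k W x \<noteq> 0"
    and nz: "V ^ 3 + W ^ 3 \<noteq> 0"
    and k: "k mod 3 = 2"
  defines "Z \<equiv> form_zeros (3 * k) (V ^ 3 + W ^ 3)"
  assumes mult: "\<And>x. x \<in># Z \<Longrightarrow> count Z x = 1 \<or> count Z x = 3"
  shows "card {x. count Z x = 1} \<ge> 6"
proof -
  obtain \<omega> :: complex where \<omega>: "\<omega>\<^sup>2 = - \<omega> - 1" "\<omega> \<noteq> 1" "\<omega>\<^sup>2 \<noteq> 1" "\<omega>\<^sup>2 \<noteq> \<omega>"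
    by (rule primitive_cube_root_exists)
  define G where "G c = V + smult c W" for c
  define R where "R c = form_zeros k (G c)" for c
  define A where "A c = {x. count (R c) x = 1}" for c
  have eq: "V ^ 3 + W ^ 3 = G 1 * (G \<omega> * G (\<omega>\<^sup>2))"
    using sum_of_cubes_factorization[OF \<omega>(1)] by (simp add: G_def)
  have dG: "degree (G c) \<le> k" for c
    using deg by (auto simp: G_def intro!: degree_add_le order_trans[OF degree_smult_le])
  have nzG: "G 1 \<noteq> 0" "G \<omega> \<noteq> 0" "G (\<omega>\<^sup>2) \<noteq> 0"
    using nz unfolding eq by auto
  have "3 * k = k + (k + k)"
    by simp
  then have "Z = form_zeros (k + (k + k)) (G 1 * (G \<omega> * G (\<omega>\<^sup>2)))"
    unfolding Z_def eq by (simp only:)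
  also have "\<dots> = R 1 + (R \<omega> + R (\<omega>\<^sup>2))"
    using nzG dG order_trans[OF degree_mult_le add_mono[OF dG dG]]
    by (simp add: form_zeros_mult R_def)
  finally have Z: "Z = R 1 + (R \<omega> + R (\<omega>\<^sup>2))" .
  have disjR: "x \<notin># R c \<or> x \<notin># R c'" if "c \<noteq> c'" "G c \<noteq> 0" "G c' \<noteq> 0" for c c' x
  proof (rule ccontr)
    assume "\<not> ?thesis"
    then have "form_value k V x + c * form_value k W x = 0"
      and "form_value k V x + c' * form_value k W x = 0"
      using that(2,3) dG by (auto simp: R_def in_form_zeros_iff) (auto simp: G_def)
    then have "(c - c') * form_value k W x = 0" and V: "form_value k V x = - (c * form_value k W x)"
      by algebra+
    then have "form_value k W x = 0"
      using that(1) by simp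
    with V disj[of x] show False
      by simp
  qed
  note disjR' = disjR[OF \<omega>(2) nzG(2,1)] disjR[OF \<omega>(3) nzG(3,1)] disjR[OF \<omega>(4) nzG(3,2)]
  have countZ: "count Z x = count (R c) x" if "x \<in># R c" "c \<in> {1, \<omega>, \<omega>\<^sup>2}" for x c
    using that disjR'[of x] by (auto simp: Z count_eq_zero_iff)
  have subZ: "x \<in># Z" if "x \<in># R c" "c \<in> {1, \<omega>, \<omega>\<^sup>2}" for x c
    using that by (auto simp: Z)
  have card_A: "card (A c) \<ge> 2" if "c \<in> {1, \<omega>, \<omega>\<^sup>2}" for c
    unfolding A_def
  proof (rule two_simple_elements)
    show "count (R c) x = 1 \<or> count (R c) x = 3" if "x \<in># R c" for x
      using mult[of x] countZ[OF that] subZ[OF that] \<open>c \<in> {1, \<omega>, \<omega>\<^sup>2}\<close> by metis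
    show "size (R c) mod 3 = 2"
      using k dG by (simp add: R_def size_form_zeros)
  qed
  have AR: "A c \<subseteq> set_mset (R c)" for c
    by (auto simp: A_def simp flip: count_greater_zero_iff)
  then have fin: "finite (A c)" for c
    by (rule finite_subset) simp
  have dis: "A 1 \<inter> A \<omega> = {}" "(A 1 \<union> A \<omega>) \<inter> A (\<omega>\<^sup>2) = {}"
    using AR disjR' by blast+
  have "6 \<le> card (A 1) + card (A \<omega>) + card (A (\<omega>\<^sup>2))"
    using card_A[of 1] card_A[of \<omega>] card_A[of "\<omega>\<^sup>2"] by simp
  also have "\<dots> = card (A 1 \<union> A \<omega> \<union> A (\<omega>\<^sup>2))"
    using dis fin by (simp add: card_Un_disjoint)
  also have "\<dots> \<le> card {x. count Z x = 1}"
  proof (rule card_mono)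
    have "{x. count Z x = 1} \<subseteq> set_mset Z"
      by (auto simp flip: count_greater_zero_iff)
    then show "finite {x. count Z x = 1}"
      by (rule finite_subset) simp
    show "A 1 \<union> A \<omega> \<union> A (\<omega>\<^sup>2) \<subseteq> {x. count Z x = 1}"
      using AR countZ by (fastforce simp: A_def)
  qed
  finally show ?thesis .
qed

lemma count_multiplicities:
  "count (image_mset (count Z) (mset_set (set_mset Z))) n = card {x \<in> set_mset Z. count Z x = n}"
  by (simp add: count_image_mset Int_def vimage_def conj_commute)

lemma no_rational_map_with_cubic_fibres:
  assumes pq: "coprime p q" "max (degree p) (degree q) = 3 * k" and k: "k mod 3 = 2"
    and a: "a1 \<noteq> a2" "a1 \<noteq> a3" "a2 \<noteq> a3"
    and fib1: "fibre_partition (sphere_map p q) a1 = replicate_mset (k - 1) 3 + replicate_mset 3 1"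
    and fib23: "fibre_partition (sphere_map p q) a2 = replicate_mset k 3"
      "fibre_partition (sphere_map p q) a3 = replicate_mset k 3"
  shows False
proof -
  define N where "N = fibre_poly p q"
  define Z where "Z a = form_zeros (3 * k) (N a)" for a
  have d: "3 * k = max (degree p) (degree q)" "3 * k > 0"
    using pq k by auto
  have fibre: "fibre_partition (sphere_map p q) a = image_mset (count (Z a)) (mset_set (set_mset (Z a)))" for a
    using fibre_partition_sphere_map[OF pq(1) d] by (simp add: Z_def N_def)
  have N0: "N a \<noteq> 0" and dN: "degree (N a) \<le> 3 * k" for a
    using fibre_poly_nonzero[OF pq(1)] degree_fibre_poly_le[of p q a] d by (auto simp: N_def)
  have mult: "count (Z a) x \<in># fibre_partition (sphere_map p q) a" if "x \<in># Z a" for a x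
    unfolding fibre using that by simp
  have mult1: "count (Z a1) x = 1 \<or> count (Z a1) x = 3" if "x \<in># Z a1" for x
    using mult[OF that] by (auto simp: fib1 split: if_splits)
  have mult2: "count (Z a2) x = 3" if "x \<in># Z a2" for x
    using mult[OF that] by (auto simp: fib23 split: if_splits)
  have mult3: "count (Z a3) x = 3" if "x \<in># Z a3" for x
    using mult[OF that] by (auto simp: fib23 split: if_splits)
  obtain \<alpha> \<beta> where \<alpha>\<beta>: "\<alpha> \<noteq> 0" "\<beta> \<noteq> 0" "N a1 = smult \<alpha> (N a2) + smult \<beta> (N a3)"
    using fibre_poly_linear_relation[OF a, of p q] by (auto simp: N_def)
  obtain V where V: "V ^ 3 = smult \<alpha> (N a2)" "V \<noteq> 0" "degree V \<le> k"
    using cube_root_of_form[of "smult \<alpha> (N a2)" k] N0 dN \<alpha>\<beta> mult2 by (auto simp: Z_def)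
  obtain W where W: "W ^ 3 = smult \<beta> (N a3)" "W \<noteq> 0" "degree W \<le> k"
    using cube_root_of_form[of "smult \<beta> (N a3)" k] N0 dN \<alpha>\<beta> mult3 by (auto simp: Z_def)
  have cube: "form_value (3 * k) (U ^ 3) x = 0" if "form_value k U x = 0" "U \<noteq> 0" "degree U \<le> k"
    for U :: "complex poly" and x
  proof -
    have deg: "degree (U * U) \<le> k + k" "degree (U * (U * U)) \<le> k + (k + k)"
      using that(3) by (simp_all add: degree_mult_eq that(2))
    have "x \<in># form_zeros (k + (k + k)) (U * (U * U))"
      using that deg in_form_zeros_iff[of U k x] by (simp add: form_zeros_mult)
    then show ?thesis
      using in_form_zeros_iff[of "U * (U * U)" "k + (k + k)" x] that(2) deg(2)
      by (simp add: power3_eq_cube mult.assoc numeral_3_eq_3)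
  qed
  \<comment> \<open>A common zero of \<open>V\<close> and \<open>W\<close> would lie over both \<open>a2\<close> and \<open>a3\<close>.\<close>
  have disj: "form_value k V x \<noteq> 0 \<or> form_value k W x \<noteq> 0" for x
  proof (rule ccontr)
    assume "\<not> ?thesis"
    then have "form_value (3 * k) (N a2) x = 0" "form_value (3 * k) (N a3) x = 0"
      using cube[of V x] cube[of W x] V W \<alpha>\<beta> by auto
    then have "sphere_map p q x = a2" "sphere_map p q x = a3"
      using sphere_map_eq_iff[OF pq(1) d] by (auto simp: N_def)
    then show False
      using a(3) by simp
  qed
  have N1: "V ^ 3 + W ^ 3 = N a1"
    by (simp add: V W \<alpha>\<beta>)
  have "6 \<le> card {x. count (Z a1) x = 1}"
    using six_simple_zeros_of_sum_of_cubes[OF V(3) W(3) disj _ k] N0 mult1 unfolding N1 by (simp add: Z_def)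
  also have "{x. count (Z a1) x = 1} = {x \<in> set_mset (Z a1). count (Z a1) x = 1}"
    by (auto simp flip: count_greater_zero_iff)
  also have "card \<dots> = count (fibre_partition (sphere_map p q) a1) 1"
    by (simp only: fibre count_multiplicities)
  also have "\<dots> = 3"
    by (simp add: fib1)
  finally show False
    by simp
qed

text \<open>
  The branching points form a set, so each is counted once, and even equal partitions in the datum
  come from different points.
\<close>
lemma branching_points_of_datum3:
  assumes "branching_datum h = {# A, B, C #}"
  obtains a1 a2 a3 where "a1 \<noteq> a2" "a1 \<noteq> a3" "a2 \<noteq> a3"
    "fibre_partition h a1 = A" "fibre_partition h a2 = B" "fibre_partition h a3 = C"
proof -
  define f where "f = fibre_partition h"
  obtain a1 M1 where 1: "mset_set (branching_points h) = add_mset a1 M1" "f a1 = A"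
    "image_mset f M1 = {# B, C #}"
    using assms msed_map_invR unfolding branching_datum_def f_def by metis
  obtain a2 M2 where 2: "M1 = add_mset a2 M2" "f a2 = B" "image_mset f M2 = {# C #}"
    using msed_map_invR[OF 1(3)] by metis
  obtain a3 where 3: "M2 = {# a3 #}" "f a3 = C"
    using msed_map_invR[OF 2(3)] by auto
  have "count {# a1, a2, a3 #} x \<le> 1" for x
    using 1(1) unfolding 2(1) 3(1) by (metis count_mset_set' le_refl zero_le_one)
  from this[of a1] this[of a2] have "a1 \<noteq> a2" "a1 \<noteq> a3" "a2 \<noteq> a3"
    by (auto split: if_splits)
  then show ?thesis
    using that 1(2) 2(2) 3(2) unfolding f_def by blast
qed

theorem proposition1p5:
  fixes d k l :: nat
  assumes "l \<ge> 1"
    and "k = 2 + 3 * l"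
    and "d = 3 * k"
  shows "exceptional d
           {# replicate_mset (k - 1) 3 + replicate_mset 3 1,
              replicate_mset k 3,
              replicate_mset k 3 #}"
  unfolding exceptional_def
proof
  show "candidate_branching_datum d
      {# replicate_mset (k - 1) 3 + replicate_mset 3 1, replicate_mset k 3, replicate_mset k 3 #}"
    using assms
    by (auto simp: candidate_branching_datum_def is_partition_of_def trivial_partition_def
        sum_mset_replicate_mset)
  show "\<not> (\<exists>h. rational_map_of_degree d h \<and> branching_datum h =
      {# replicate_mset (k - 1) 3 + replicate_mset 3 1, replicate_mset k 3, replicate_mset k 3 #})"
  proof (intro notI, elim exE conjE)
    fix h
    assume h: "rational_map_of_degree d h" and datum: "branching_datum h =
      {# replicate_mset (k - 1) 3 + replicate_mset 3 1, replicate_mset k 3, replicate_mset k 3 #}"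
    obtain p q where pq: "coprime p q" "max (degree p) (degree q) = 3 * k" "h = sphere_map p q"
      using h assms(3) by (auto simp: rational_map_of_degree_def)
    have "k mod 3 = 2"
      using assms(2) by presburger
    with branching_points_of_datum3[OF datum] show False
      using no_rational_map_with_cubic_fibres[OF pq(1,2)] unfolding pq(3) by metis
  qed
qed

end
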